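(* The set $\Sigma_0=\{X_0,\ CX_{0,1},\ CCX_{1,2},\ K_{1,2}\}$ of $8\times 8$ matrices is a minimal generating set for $W(E_8)$: it generates $W(E_8)$, and no proper subset of $\Sigma_0$ generates $W(E_8)$.
   Context: Qubits are labelled $0,1,2$; the basis vector $|x_0x_1x_2\rangle$ is identified with $e_{4x_0+2x_1+x_2}\in\mathbb{R}^8$. $X=\begin{bmatrix}0&1\\1&0\end{bmatrix}$, $H=\frac1{\sqrt2}\begin{bmatrix}1&1\\1&-1\end{bmatrix}$, and $M_j$ denotes $M$ acting on qubit $j$ (e.g. $X_0=X\otimes I\otimes I$). $CX_{0,1}$ sends $|x_0x_1x_2\rangle$ to $|x_0,x_1\oplus x_0,x_2\rangle$; $CCX_{1,2}$ sends $|x_0x_1x_2\rangle$ to $|x_0\oplus x_1x_2,x_1,x_2\rangle$; $K_{1,2}=I\otimes H\otimes H$. With $\mathbb{D}=\mathbb{Z}[1/2]$ and $\Gamma_8=\{x\in\mathbb{Z}^8\cup(\mathbb{Z}+\tfrac12)^8:\sum_ix_i\equiv0\pmod2\}$ (the $E_8$ lattice), $W(E_8)$ is the group of $8\times8$ orthogonal matrices $M$ with entries in $\mathbb{D}$ satisfying $M\Gamma_8=\Gamma_8$. *)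

theory Defs
  imports "Jordan_Normal_Form.Matrix"
begin

text \<open>Qubit j of the basis index i (qubit 0 is the most significant bit):
  the basis vector |x0 x1 x2> is e_(4 x0 + 2 x1 + x2).\<close>
definition qbit :: "nat \<Rightarrow> nat \<Rightarrow> nat" where
  "qbit q i = (i div 2 ^ (2 - q)) mod 2"

definition idx3 :: "nat \<Rightarrow> nat \<Rightarrow> nat \<Rightarrow> nat" where
  "idx3 a b c = 4 * a + 2 * b + c"

definition perm_mat8 :: "(nat \<Rightarrow> nat) \<Rightarrow> real mat" where
  "perm_mat8 p = mat 8 8 (\<lambda>(i, j). if i = p j then 1 else 0)"

definition X0 :: "real mat" where
  "X0 = perm_mat8 (\<lambda>j. idx3 ((qbit 0 j + 1) mod 2) (qbit 1 j) (qbit 2 j))"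

definition CX01 :: "real mat" where
  "CX01 = perm_mat8 (\<lambda>j. idx3 (qbit 0 j) ((qbit 1 j + qbit 0 j) mod 2) (qbit 2 j))"

definition CCX12 :: "real mat" where
  "CCX12 = perm_mat8 (\<lambda>j. idx3 ((qbit 0 j + qbit 1 j * qbit 2 j) mod 2) (qbit 1 j) (qbit 2 j))"

text \<open>K_{1,2} = I \<otimes> H \<otimes> H, written entrywise.\<close>
definition K12 :: "real mat" where
  "K12 = mat 8 8 (\<lambda>(i, j). if qbit 0 i = qbit 0 j
      then (-1) ^ (qbit 1 i * qbit 1 j + qbit 2 i * qbit 2 j) / 2 else 0)"

definition Sigma0 :: "real mat set" where
  "Sigma0 = {X0, CX01, CCX12, K12}"

definition dyadic :: "real \<Rightarrow> bool" where
  "dyadic x \<longleftrightarrow> (\<exists>(a::int) (n::nat). x = of_int a / 2 ^ n)"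

definition Gamma8 :: "real vec set" where
  "Gamma8 = {v \<in> carrier_vec 8.
     ((\<forall>i<8. v $ i \<in> \<int>) \<or> (\<forall>i<8. v $ i - 1/2 \<in> \<int>)) \<and>
     (\<exists>k::int. (\<Sum>i<8. v $ i) = 2 * of_int k)}"

definition WE8 :: "real mat set" where
  "WE8 = {M \<in> carrier_mat 8 8.
     M * transpose_mat M = 1\<^sub>m 8 \<and> transpose_mat M * M = 1\<^sub>m 8 \<and>
     (\<forall>i<8. \<forall>j<8. dyadic (M $$ (i, j))) \<and>
     (\<lambda>v. M *\<^sub>v v) ` Gamma8 = Gamma8}"

inductive_set gen_group :: "real mat set \<Rightarrow> real mat set" for S where
  gen_one: "1\<^sub>m 8 \<in> gen_group S"
| gen_base: "A \<in> S \<Longrightarrow> A \<in> gen_group S"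
| gen_mult: "A \<in> gen_group S \<Longrightarrow> B \<in> gen_group S \<Longrightarrow> A * B \<in> gen_group S"
| gen_inv: "A \<in> gen_group S \<Longrightarrow> B \<in> carrier_mat 8 8 \<Longrightarrow> A * B = 1\<^sub>m 8 \<Longrightarrow> B * A = 1\<^sub>m 8
            \<Longrightarrow> B \<in> gen_group S"

end

theory Submission
  imports Defs "Jordan_Normal_Form.Determinant"
begin

text \<open>\<open>CCX12\<close> is the reflection in the root \<open>e\<^sub>3 - e\<^sub>7\<close>, so every element of the group \<open>G\<close> generated by
  \<open>Sigma0\<close> carries it to another reflection in \<open>G\<close>; following the orbit of that root, one meets all
  simple roots of the root system \<open>E\<^sub>8\<close>. Reflecting in simple roots moves any lattice vector into the
  dominant chamber, because each useful reflection brings it closer to the Weyl vector.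

  The only dominant lattice vector of squared length 4 is \<open>2 e\<^sub>7\<close>. Hence for \<open>M\<close> in \<open>WE8\<close> some \<open>A\<close> in \<open>G\<close>
  makes \<open>A M\<close> fix \<open>e\<^sub>7\<close>. Then \<open>A M (e\<^sub>j - e\<^sub>7)\<close> is a lattice vector with last coordinate \<open>-1\<close>, hence
  integral, so \<open>A M\<close> is a signed permutation matrix; making the image of the Weyl vector
  dominant for the subsystem \<open>D\<^sub>7\<close> turns it into the identity.

  For minimality, the three generators other than \<open>X0\<close>, \<open>CX01\<close> or \<open>K12\<close> have a common fixed vector
  that the omitted one moves, and all generators except \<open>CCX12\<close> have determinant 1.\<close>

section \<open>Vectors of length 8\<close>

definition vec8 :: "real \<Rightarrow> real \<Rightarrow> real \<Rightarrow> real \<Rightarrow> real \<Rightarrow> real \<Rightarrow> real \<Rightarrow> real \<Rightarrow> real vec" where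
  "vec8 a b c d e f g h = vec 8 (\<lambda>i. [a, b, c, d, e, f, g, h] ! i)"

text \<open>Enumerating the indices turns bounded quantifiers, sums and checks of permutations into
  finite case splits.\<close>

lemma less_8_cases: "i < 8 \<longleftrightarrow> i \<in> {0, 1, 2, 3, 4, 5, 6, 7::nat}"
  by (simp add: numeral_eq_Suc less_Suc_eq)

lemma all_less_8:
  "(\<forall>i<8. P i) \<longleftrightarrow> P 0 \<and> P 1 \<and> P 2 \<and> P 3 \<and> P 4 \<and> P 5 \<and> P 6 \<and> P (7::nat)"
  unfolding less_8_cases Ball_def[symmetric] by simp

lemma sum_less_8:
  fixes f :: "nat \<Rightarrow> 'a::comm_monoid_add"
  shows "(\<Sum>i = 0..<8. f i) = f 0 + f 1 + f 2 + f 3 + f 4 + f 5 + f 6 + f 7"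
    and "(\<Sum>i<8. f i) = f 0 + f 1 + f 2 + f 3 + f 4 + f 5 + f 6 + f 7"
proof -
  have *: "{0..<8} = {0, 1, 2, 3, 4, 5, 6, 7::nat}"
    by (rule Set.set_eqI) (simp add: less_8_cases)
  show "(\<Sum>i = 0..<8. f i) = f 0 + f 1 + f 2 + f 3 + f 4 + f 5 + f 6 + f 7"
    unfolding * by (simp add: add.assoc)
  then show "(\<Sum>i<8. f i) = f 0 + f 1 + f 2 + f 3 + f 4 + f 5 + f 6 + f 7"
    by (simp add: lessThan_atLeast0)
qed

lemma vec8_carrier [simp]: "vec8 a b c d e f g h \<in> carrier_vec 8"
  and dim_vec8 [simp]: "dim_vec (vec8 a b c d e f g h) = 8"
  by (simp_all add: vec8_def)

lemma vec8_index [simp]: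
  "vec8 a b c d e f g h $ 0 = a" "vec8 a b c d e f g h $ 1 = b"
  "vec8 a b c d e f g h $ 2 = c" "vec8 a b c d e f g h $ 3 = d"
  "vec8 a b c d e f g h $ 4 = e" "vec8 a b c d e f g h $ 5 = f"
  "vec8 a b c d e f g h $ 6 = g" "vec8 a b c d e f g h $ 7 = h"
  "vec8 a b c d e f g h $ Suc 0 = b"
  by (simp_all add: vec8_def)

lemma eq_vec8I:
  fixes v w :: "real vec"
  assumes "dim_vec v = 8" "dim_vec w = 8"
    and "v $ 0 = w $ 0" "v $ 1 = w $ 1" "v $ 2 = w $ 2" "v $ 3 = w $ 3"
    and "v $ 4 = w $ 4" "v $ 5 = w $ 5" "v $ 6 = w $ 6" "v $ 7 = w $ 7"
  shows "v = w"
proof (rule eq_vecI)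
  fix i assume "i < dim_vec w"
  with assms(2) have "i < 8" by simp
  then show "v $ i = w $ i" using assms unfolding less_8_cases by auto
qed (use assms in auto)

lemma vec8_expand:
  assumes "v \<in> carrier_vec 8"
  shows "v = vec8 (v $ 0) (v $ 1) (v $ 2) (v $ 3) (v $ 4) (v $ 5) (v $ 6) (v $ 7)"
  by (rule eq_vec8I) (use assms in auto)

lemma scalar_prod_8:
  "w \<in> carrier_vec 8 \<Longrightarrow> v \<bullet> w = v $ 0 * w $ 0 + v $ 1 * w $ 1 + v $ 2 * w $ 2 + v $ 3 * w $ 3
     + v $ 4 * w $ 4 + v $ 5 * w $ 5 + v $ 6 * w $ 6 + v $ 7 * w $ 7"
  by (simp add: scalar_prod_def sum_less_8 carrier_vecD)

section \<open>The generators as symmetric involutions in coordinates\<close>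

lemma Sigma0_carrier [simp]:
  "X0 \<in> carrier_mat 8 8" "CX01 \<in> carrier_mat 8 8" "CCX12 \<in> carrier_mat 8 8" "K12 \<in> carrier_mat 8 8"
  by (simp_all add: X0_def CX01_def CCX12_def K12_def perm_mat8_def)

lemma X0_mult_vec8: "X0 *\<^sub>v vec8 a b c d e f g h = vec8 e f g h a b c d"
  by (rule eq_vec8I) (simp_all add: scalar_prod_8 X0_def perm_mat8_def idx3_def qbit_def)

lemma CX01_mult_vec8: "CX01 *\<^sub>v vec8 a b c d e f g h = vec8 a b c d g h e f"
  by (rule eq_vec8I) (simp_all add: scalar_prod_8 CX01_def perm_mat8_def idx3_def qbit_def)

lemma CCX12_mult_vec8: "CCX12 *\<^sub>v vec8 a b c d e f g h = vec8 a b c h e f g d"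
  by (rule eq_vec8I) (simp_all add: scalar_prod_8 CCX12_def perm_mat8_def idx3_def qbit_def)

lemma K12_mult_vec8:
  "K12 *\<^sub>v vec8 a b c d e f g h =
     vec8 ((a + b + c + d) / 2) ((a - b + c - d) / 2) ((a + b - c - d) / 2) ((a - b - c + d) / 2)
       ((e + f + g + h) / 2) ((e - f + g - h) / 2) ((e + f - g - h) / 2) ((e - f - g + h) / 2)"
  by (rule eq_vec8I) (simp_all add: scalar_prod_8 K12_def qbit_def diff_divide_distrib add_divide_distrib)

lemmas Sigma0_mult_vec8 = X0_mult_vec8 CX01_mult_vec8 CCX12_mult_vec8 K12_mult_vec8

lemma perm_mat8_symmetric:
  assumes "\<And>i. i < 8 \<Longrightarrow> p (p i) = i"
  shows "transpose_mat (perm_mat8 p) = perm_mat8 p"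
  by (rule eq_matI) (auto simp: perm_mat8_def assms)

lemma Sigma0_symmetric: "A \<in> Sigma0 \<Longrightarrow> transpose_mat A = A"
proof -
  have "transpose_mat X0 = X0"
    unfolding X0_def
    by (rule perm_mat8_symmetric, unfold less_8_cases, elim insertE emptyE)
      (simp_all add: idx3_def qbit_def)
  moreover have "transpose_mat CX01 = CX01"
    unfolding CX01_def
    by (rule perm_mat8_symmetric, unfold less_8_cases, elim insertE emptyE)
      (simp_all add: idx3_def qbit_def)
  moreover have "transpose_mat CCX12 = CCX12"
    unfolding CCX12_def
    by (rule perm_mat8_symmetric, unfold less_8_cases, elim insertE emptyE)
      (simp_all add: idx3_def qbit_def)
  moreover have "transpose_mat K12 = K12"
    by (rule eq_matI) (auto simp: K12_def mult.commute)
  ultimately show "A \<in> Sigma0 \<Longrightarrow> transpose_mat A = A" by (auto simp: Sigma0_def)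
qed

text \<open>Reduces a matrix identity to a computation on a generic \<open>vec8\<close>; unit
  vectors recover the entries.\<close>

lemma eq_mat8_on_vecI:
  fixes A B :: "real mat"
  assumes "A \<in> carrier_mat 8 8" "B \<in> carrier_mat 8 8"
    and "\<And>v. v \<in> carrier_vec 8 \<Longrightarrow> A *\<^sub>v v = B *\<^sub>v v"
  shows "A = B"
proof (rule eq_matI)
  fix i j assume "i < dim_row B" "j < dim_col B"
  then show "A $$ (i, j) = B $$ (i, j)"
    using assms(1,2) arg_cong[OF assms(3)[of "unit_vec 8 j"], of "\<lambda>v. v $ i"] by simp
qed (use assms in auto)

text \<open>Checked on generic coordinates. Together with \<open>Sigma0_symmetric\<close> it makes
  every generator orthogonal and its own inverse.\<close>

lemma Sigma0_involution: "A \<in> Sigma0 \<Longrightarrow> A * A = 1\<^sub>m 8"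
proof -
  assume A: "A \<in> Sigma0"
  then have c: "A \<in> carrier_mat 8 8" by (auto simp: Sigma0_def)
  have "A *\<^sub>v (A *\<^sub>v vec8 a b c d e f g h) = vec8 a b c d e f g h" for a b c d e f g h
    using A unfolding Sigma0_def
    by (elim insertE emptyE)
      (simp_all add: Sigma0_mult_vec8 add_divide_distrib diff_divide_distrib)
  then have "A *\<^sub>v (A *\<^sub>v v) = v" if "v \<in> carrier_vec 8" for v
    using vec8_expand[OF that] by metis
  with c show ?thesis by (intro eq_mat8_on_vecI) auto
qed

section \<open>The lattice and its orthogonal group\<close>

lemma Gamma8_carrier: "v \<in> Gamma8 \<Longrightarrow> v \<in> carrier_vec 8"
  by (simp add: Gamma8_def)

lemma vec8_in_Gamma8_iff:
  "vec8 a b c d e f g h \<in> Gamma8 \<longleftrightarrow>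
     ((a \<in> \<int> \<and> b \<in> \<int> \<and> c \<in> \<int> \<and> d \<in> \<int> \<and> e \<in> \<int> \<and> f \<in> \<int> \<and> g \<in> \<int> \<and> h \<in> \<int>) \<or>
      (a - 1/2 \<in> \<int> \<and> b - 1/2 \<in> \<int> \<and> c - 1/2 \<in> \<int> \<and> d - 1/2 \<in> \<int> \<and>
       e - 1/2 \<in> \<int> \<and> f - 1/2 \<in> \<int> \<and> g - 1/2 \<in> \<int> \<and> h - 1/2 \<in> \<int>)) \<and>
     (\<exists>k::int. a + b + c + d + e + f + g + h = 2 * of_int k)"
  unfolding Gamma8_def mem_Collect_eq all_less_8 sum_less_8 by simp

lemma half_Ints_cases:
  fixes x :: real
  assumes "2 * x \<in> \<int>"
  shows "x \<in> \<int> \<or> x - 1/2 \<in> \<int>"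
proof -
  from assms obtain n :: int where n: "2 * x = of_int n" by (auto elim: Ints_cases)
  show ?thesis
  proof (cases "even n")
    case True
    then obtain m where "n = 2 * m" by auto
    with n have "x = of_int m" by simp
    then show ?thesis by simp
  next
    case False
    then obtain m where "n = 2 * m + 1" by (auto elim: oddE)
    with n have "x - 1/2 = of_int m" by simp
    then show ?thesis by (metis Ints_of_int)
  qed
qed

text \<open>Every output coordinate differs by an integer from \<open>y\<close> or \<open>z\<close>,
  the half-sums of the two blocks of four coordinates. As \<open>y + z\<close> is an integer,
  \<open>y\<close> and \<open>z\<close> are both integers or both half-odd, and the outputs with
  them. The outputs add up to \<open>2 * (a + e)\<close>, where \<open>a + e\<close> is an
  integer.\<close>

lemma K12_preserves_Gamma8:
  assumes "vec8 a b c d e f g h \<in> Gamma8"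
  shows "K12 *\<^sub>v vec8 a b c d e f g h \<in> Gamma8"
proof -
  from assms obtain k :: int where k: "a + b + c + d + e + f + g + h = 2 * of_int k"
    by (auto simp: vec8_in_Gamma8_iff)
  have add_Ints: "x + y \<in> \<int>"
    if "x \<in> \<int> \<and> y \<in> \<int> \<or> x - 1/2 \<in> \<int> \<and> y - 1/2 \<in> \<int>" for x y :: real
    using that
  proof
    assume "x - 1/2 \<in> \<int> \<and> y - 1/2 \<in> \<int>"
    then have "(x - 1/2) + (y - 1/2) + 1 \<in> \<int>" by (intro Ints_add Ints_1) auto
    then show ?thesis by simp
  qed auto
  have int: "a + b \<in> \<int>" "c + d \<in> \<int>" "b + d \<in> \<int>" "b + c \<in> \<int>" "f + h \<in> \<int>" "g + h \<in> \<int>" "f + g \<in> \<int>" "a + e \<in> \<int>"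
    by (rule add_Ints, use assms in \<open>auto simp: vec8_in_Gamma8_iff\<close>)+
  define y where "y = (a + b + c + d) / 2"
  define z where "z = (e + f + g + h) / 2"
  have yz: "z = of_int k - y" using k by (simp add: y_def z_def field_simps)
  have "2 * y = (a + b) + (c + d)" by (simp add: y_def)
  then have "2 * y \<in> \<int>" using int by simp
  then have "y \<in> \<int> \<or> y - 1/2 \<in> \<int>" by (rule half_Ints_cases)
  moreover have "K12 *\<^sub>v vec8 a b c d e f g h =
      vec8 y (y - (b + d)) (y - (c + d)) (y - (b + c)) z (z - (f + h)) (z - (g + h)) (z - (f + g))"
    unfolding K12_mult_vec8 y_def z_def
    by (rule eq_vec8I) (simp_all add: field_simps)
  moreover have "y + (y - (b + d)) + (y - (c + d)) + (y - (b + c)) + z + (z - (f + h)) + (z - (g + h)) + (z - (f + g)) = 2 * (a + e)"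
    by (simp add: y_def z_def field_simps)
  moreover obtain m :: int where "a + e = of_int m" using int(8) by (auto elim: Ints_cases)
  moreover have "z \<in> \<int>" if "y \<in> \<int>" using that by (simp add: yz)
  moreover have "z - 1/2 \<in> \<int>" if "y - 1/2 \<in> \<int>"
  proof -
    have "z - 1/2 = of_int k - (y - 1/2) - 1" by (simp add: yz)
    with that show ?thesis by (metis Ints_diff Ints_of_int Ints_1)
  qed
  moreover have "u - v - 1/2 \<in> \<int>" if "u - 1/2 \<in> \<int>" "v \<in> \<int>" for u v :: real
    using Ints_diff[OF that] by (simp add: algebra_simps)
  ultimately show ?thesis using int by (auto simp: vec8_in_Gamma8_iff)
qed

lemma Sigma0_preserves_Gamma8:
  assumes "A \<in> Sigma0" "v \<in> Gamma8"
  shows "A *\<^sub>v v \<in> Gamma8"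
proof -
  have "A *\<^sub>v vec8 a b c d e f g h \<in> Gamma8" if v: "vec8 a b c d e f g h \<in> Gamma8" for a b c d e f g h
    using assms(1) v K12_preserves_Gamma8[OF v] unfolding Sigma0_def
    by (elim insertE emptyE) (auto simp: Sigma0_mult_vec8 vec8_in_Gamma8_iff ac_simps)
  then show ?thesis using vec8_expand[OF Gamma8_carrier[OF assms(2)]] assms(2) by metis
qed

text \<open>Half-odd coordinates are shifted by 1/2 to become integers; the correction terms are
  halves of coordinate sums, and these sums are even.\<close>

lemma Gamma8_scalar_prod_Ints:
  assumes "v \<in> Gamma8" "w \<in> Gamma8"
  shows "v \<bullet> w \<in> \<int>"
proof -
  have mixed: "x \<bullet> y \<in> \<int>"
    if x: "x \<in> Gamma8" "\<forall>i<8. x $ i \<in> \<int>" and y: "y \<in> Gamma8" for x y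
  proof (cases "\<forall>i<8. y $ i \<in> \<int>")
    case True
    then show ?thesis using x y Gamma8_carrier[OF y]
      by (auto simp: scalar_prod_def intro!: Ints_sum Ints_mult)
  next
    case False
    with y have half: "\<forall>i<8. y $ i - 1/2 \<in> \<int>" by (auto simp: Gamma8_def)
    obtain k :: int where k: "(\<Sum>i<8. x $ i) = 2 * of_int k" using x by (auto simp: Gamma8_def)
    have "x \<bullet> y = (\<Sum>i<8. x $ i * (y $ i - 1/2)) + (\<Sum>i<8. x $ i) / 2"
      using Gamma8_carrier[OF y]
      by (simp add: scalar_prod_def lessThan_atLeast0 algebra_simps sum_subtractf sum_divide_distrib)
    also have "\<dots> = (\<Sum>i<8. x $ i * (y $ i - 1/2)) + of_int k" by (simp add: k)
    also have "\<dots> \<in> \<int>" using x half by (intro Ints_add Ints_sum Ints_mult) auto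
    finally show ?thesis .
  qed
  show ?thesis
  proof (cases "(\<forall>i<8. v $ i \<in> \<int>) \<or> (\<forall>i<8. w $ i \<in> \<int>)")
    case True
    then show ?thesis
      using mixed assms comm_scalar_prod[of v 8 w] Gamma8_carrier by metis
  next
    case False
    with assms have half: "\<forall>i<8. v $ i - 1/2 \<in> \<int>" "\<forall>i<8. w $ i - 1/2 \<in> \<int>" by (auto simp: Gamma8_def)
    obtain k l :: int where kl: "(\<Sum>i<8. v $ i) = 2 * of_int k" "(\<Sum>i<8. w $ i) = 2 * of_int l"
      using assms by (auto simp: Gamma8_def)
    \<comment> \<open>The constant 2 is 8 times 1/4, from the product of the two shifts in each
      coordinate.\<close>
    have "v \<bullet> w = (\<Sum>i<8. (v $ i - 1/2) * (w $ i - 1/2)) + (\<Sum>i<8. v $ i) / 2 + (\<Sum>i<8. w $ i) / 2 - 2"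
      unfolding scalar_prod_8[OF Gamma8_carrier[OF assms(2)]] sum_less_8 by (simp add: field_simps)
    also have "\<dots> = (\<Sum>i<8. (v $ i - 1/2) * (w $ i - 1/2)) + of_int (k + l - 2)" by (simp add: kl)
    also have "\<dots> \<in> \<int>" using half by (intro Ints_add Ints_sum Ints_mult) auto
    finally show ?thesis .
  qed
qed

section \<open>Dyadic entries and the group structure of \<open>WE8\<close>\<close>

lemma dyadic_of_int [simp]: "dyadic (of_int a)"
  unfolding dyadic_def by (rule exI[of _ a], rule exI[of _ 0]) simp

lemma dyadic_0 [simp]: "dyadic 0" and dyadic_1 [simp]: "dyadic 1"
  using dyadic_of_int[of 0] dyadic_of_int[of 1] by simp_all

lemma dyadic_mult: "dyadic x \<Longrightarrow> dyadic y \<Longrightarrow> dyadic (x * y)"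
  unfolding dyadic_def
proof (elim exE)
  fix a b :: int and m n :: nat
  assume "x = of_int a / 2 ^ m" "y = of_int b / 2 ^ n"
  then have "x * y = of_int (a * b) / 2 ^ (m + n)" by (simp add: power_add)
  then show "\<exists>a n. x * y = of_int a / 2 ^ n" by blast
qed

lemma dyadic_add: "dyadic x \<Longrightarrow> dyadic y \<Longrightarrow> dyadic (x + y)"
  unfolding dyadic_def
proof (elim exE)
  fix a b :: int and m n :: nat
  assume xy: "x = of_int a / 2 ^ m" "y = of_int b / 2 ^ n"
  have "x + y = of_int (a * 2 ^ n + b * 2 ^ m) / 2 ^ (m + n)"
    unfolding xy by (simp add: power_add field_simps)
  then show "\<exists>a n. x + y = of_int a / 2 ^ n" by blast
qed

lemma dyadic_sum: "(\<And>i. i \<in> I \<Longrightarrow> dyadic (f i)) \<Longrightarrow> dyadic (\<Sum>i\<in>I. f i)"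
  by (induction I rule: infinite_finite_induct) (auto intro: dyadic_add)

lemma WE8_D:
  assumes "A \<in> WE8"
  shows "A \<in> carrier_mat 8 8" "A * transpose_mat A = 1\<^sub>m 8" "transpose_mat A * A = 1\<^sub>m 8"
    "(\<lambda>v. A *\<^sub>v v) ` Gamma8 = Gamma8"
  using assms by (auto simp: WE8_def)

lemma WE8_preserves_Gamma8: "A \<in> WE8 \<Longrightarrow> v \<in> Gamma8 \<Longrightarrow> A *\<^sub>v v \<in> Gamma8"
  using WE8_D(4) by blast

lemma WE8_one: "1\<^sub>m 8 \<in> WE8"
proof -
  have "(\<lambda>v. 1\<^sub>m 8 *\<^sub>v v) ` Gamma8 = (\<lambda>v. v) ` Gamma8"
    by (rule image_cong) (auto dest: Gamma8_carrier)
  then show ?thesis by (auto simp: WE8_def)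
qed

lemma WE8_mult:
  assumes "A \<in> WE8" "B \<in> WE8"
  shows "A * B \<in> WE8"
proof -
  note A = WE8_D[OF assms(1)] and B = WE8_D[OF assms(2)]
  have t: "transpose_mat (A * B) = transpose_mat B * transpose_mat A"
    using A B by (simp add: transpose_mult[of _ 8 8 _ 8])
  have "A * B * (transpose_mat B * transpose_mat A) = A * (B * transpose_mat B) * transpose_mat A"
    using A(1) B(1) by (simp add: assoc_mult_mat[of _ 8 8 _ 8 _ 8])
  then have 1: "A * B * transpose_mat (A * B) = 1\<^sub>m 8"
    using A B unfolding t by simp
  have "transpose_mat B * transpose_mat A * (A * B) = transpose_mat B * (transpose_mat A * A) * B"
    using A(1) B(1) by (simp add: assoc_mult_mat[of _ 8 8 _ 8 _ 8])
  then have 2: "transpose_mat (A * B) * (A * B) = 1\<^sub>m 8"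
    using A B unfolding t by simp
  have 3: "dyadic ((A * B) $$ (i, j))" if "i < 8" "j < 8" for i j
    using that A(1) B(1) assms
    by (auto simp: scalar_prod_def WE8_def intro!: dyadic_sum dyadic_mult)
  have "(\<lambda>v. A * B *\<^sub>v v) ` Gamma8 = (\<lambda>v. A *\<^sub>v (B *\<^sub>v v)) ` Gamma8"
    using A(1) B(1) by (intro image_cong) (auto dest: Gamma8_carrier)
  also have "\<dots> = (\<lambda>v. A *\<^sub>v v) ` ((\<lambda>v. B *\<^sub>v v) ` Gamma8)" by (simp add: image_image)
  also have "\<dots> = Gamma8" using A B by simp
  finally show ?thesis using 1 2 3 A(1) B(1) by (auto simp: WE8_def)
qed

lemma WE8_transpose:
  assumes "A \<in> WE8"
  shows "transpose_mat A \<in> WE8"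
proof -
  note A = WE8_D[OF assms]
  have "(\<lambda>v. transpose_mat A *\<^sub>v v) ` Gamma8 = (\<lambda>v. transpose_mat A *\<^sub>v v) ` (\<lambda>v. A *\<^sub>v v) ` Gamma8"
    using A by simp
  also have "\<dots> = (\<lambda>v. (transpose_mat A * A) *\<^sub>v v) ` Gamma8"
    unfolding image_image using A(1) by (intro image_cong) (auto dest: Gamma8_carrier simp: assoc_mult_mat_vec[of _ 8 8 _ 8])
  also have "\<dots> = (\<lambda>v. v) ` Gamma8"
    unfolding A(3) by (intro image_cong) (auto dest: Gamma8_carrier)
  finally show ?thesis using assms by (auto simp: WE8_def)
qed

text \<open>Turns any inverse supplied by \<open>gen_inv\<close> into a transpose, so that
  \<open>WE8_transpose\<close> gives closure under inverses.\<close>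

lemma WE8_inverse:
  assumes "A \<in> WE8" "B \<in> carrier_mat 8 8" "B * A = 1\<^sub>m 8"
  shows "B = transpose_mat A"
proof -
  note A = WE8_D[OF assms(1)]
  have "B = B * (A * transpose_mat A)" using A assms by simp
  also have "\<dots> = B * A * transpose_mat A"
    by (rule assoc_mult_mat[symmetric]) (use A(1) assms in auto)
  finally show ?thesis unfolding assms(3) using A(1) by simp
qed

lemma WE8_scalar_prod:
  assumes "A \<in> WE8" "v \<in> carrier_vec 8" "w \<in> carrier_vec 8"
  shows "(A *\<^sub>v v) \<bullet> (A *\<^sub>v w) = v \<bullet> w"
proof -
  note A = WE8_D[OF assms(1)]
  have "(A *\<^sub>v v) \<bullet> (A *\<^sub>v w) = (transpose_mat A *\<^sub>v (A *\<^sub>v v)) \<bullet> w"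
    using A assms by (simp add: transpose_vec_mult_scalar[of _ 8 8])
  also have "transpose_mat A *\<^sub>v (A *\<^sub>v v) = v"
    using A assms by (simp add: assoc_mult_mat_vec[of _ 8 8 _ 8, symmetric])
  finally show ?thesis .
qed

lemma Sigma0_subset_WE8: "Sigma0 \<subseteq> WE8"
proof
  fix A assume A: "A \<in> Sigma0"
  then have c: "A \<in> carrier_mat 8 8" by (auto simp: Sigma0_def)
  have *: "A *\<^sub>v (A *\<^sub>v v) = v" if "v \<in> Gamma8" for v
    using Sigma0_involution[OF A] c Gamma8_carrier[OF that]
    by (simp add: assoc_mult_mat_vec[of _ 8 8 _ 8, symmetric])
  have "(\<lambda>v. A *\<^sub>v v) ` Gamma8 = Gamma8"
  proof
    show "Gamma8 \<subseteq> (\<lambda>v. A *\<^sub>v v) ` Gamma8"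
    proof
      fix v assume "v \<in> Gamma8"
      then show "v \<in> (\<lambda>v. A *\<^sub>v v) ` Gamma8"
        \<comment> \<open>An involution that maps the lattice into itself is onto:
          \<open>A *\<^sub>v v\<close> is the preimage of \<open>v\<close>.\<close>
        using * Sigma0_preserves_Gamma8[OF A] by (intro image_eqI[of _ _ "A *\<^sub>v v"]) auto
    qed
  qed (use Sigma0_preserves_Gamma8[OF A] in auto)
  moreover have "dyadic ((-1) ^ n / 2)" for n
    unfolding dyadic_def by (rule exI[of _ "(-1) ^ n"], rule exI[of _ 1]) simp
  then have "dyadic (A $$ (i, j))" if "i < 8" "j < 8" for i j
    using that A by (auto simp: Sigma0_def X0_def CX01_def CCX12_def K12_def perm_mat8_def)
  ultimately show "A \<in> WE8"
    using c Sigma0_involution[OF A] Sigma0_symmetric[OF A] by (auto simp: WE8_def)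
qed

lemma gen_group_Sigma0_subset_WE8: "gen_group Sigma0 \<subseteq> WE8"
proof
  fix A assume "A \<in> gen_group Sigma0"
  then show "A \<in> WE8"
  proof induction
    case (gen_inv A B)
    then show ?case using WE8_transpose WE8_inverse by metis
  qed (use WE8_one WE8_mult Sigma0_subset_WE8 in auto)
qed

section \<open>Reflections\<close>

text \<open>This is the orthogonal reflection only when \<open>\<alpha>\<close> has squared length 2.\<close>
definition reflection :: "real vec \<Rightarrow> real mat" where
  "reflection \<alpha> = mat 8 8 (\<lambda>(i, j). (if i = j then 1 else 0) - \<alpha> $ i * \<alpha> $ j)"

lemma reflection_carrier [simp]: "reflection \<alpha> \<in> carrier_mat 8 8"
  by (simp add: reflection_def)

lemma reflection_mult_vec:
  assumes "\<alpha> \<in> carrier_vec 8" "x \<in> carrier_vec 8"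
  shows "reflection \<alpha> *\<^sub>v x = x - (\<alpha> \<bullet> x) \<cdot>\<^sub>v \<alpha>"
proof (rule eq_vecI)
  fix i assume "i < dim_vec (x - (\<alpha> \<bullet> x) \<cdot>\<^sub>v \<alpha>)"
  with assms have i: "i < 8" by simp
  have "(reflection \<alpha> *\<^sub>v x) $ i = (\<Sum>j = 0..<8. ((if i = j then 1 else 0) - \<alpha> $ i * \<alpha> $ j) * x $ j)"
    using i assms by (simp add: reflection_def scalar_prod_def)
  also have "\<dots> = (\<Sum>j = 0..<8. (if i = j then x $ j else 0)) - (\<Sum>j = 0..<8. \<alpha> $ j * x $ j) * \<alpha> $ i"
    unfolding sum_distrib_right sum_subtractf[symmetric]
    by (rule sum.cong) (auto simp: algebra_simps)
  also have "\<dots> = (x - (\<alpha> \<bullet> x) \<cdot>\<^sub>v \<alpha>) $ i"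
    using i assms by (simp add: scalar_prod_def)
  finally show "(reflection \<alpha> *\<^sub>v x) $ i = (x - (\<alpha> \<bullet> x) \<cdot>\<^sub>v \<alpha>) $ i" .
qed (use assms in \<open>auto simp: reflection_def\<close>)

lemma reflection_uminus: "\<alpha> \<in> carrier_vec 8 \<Longrightarrow> reflection (- \<alpha>) = reflection \<alpha>"
  by (rule eq_matI) (auto simp: reflection_def)

text \<open>Since \<open>A\<close> preserves scalar products, the coefficient of \<alpha> at the
  preimage \<open>y\<close> of \<open>x\<close> is the coefficient of the image root at
  \<open>x\<close>.\<close>

lemma reflection_conjugate:
  assumes A: "A \<in> WE8" and \<alpha>: "\<alpha> \<in> carrier_vec 8"
  shows "A * reflection \<alpha> * transpose_mat A = reflection (A *\<^sub>v \<alpha>)"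
proof (rule eq_mat8_on_vecI)
  note c = WE8_D(1)[OF A]
  fix x :: "real vec" assume x: "x \<in> carrier_vec 8"
  define y where "y = transpose_mat A *\<^sub>v x"
  have y: "y \<in> carrier_vec 8" using c x by (simp add: y_def mult_mat_vec_carrier[of _ 8 8])
  have Ay: "A *\<^sub>v y = x"
    using c x WE8_D(2)[OF A] by (simp add: y_def assoc_mult_mat_vec[of _ 8 8 _ 8, symmetric])
  have "A * reflection \<alpha> * transpose_mat A *\<^sub>v x = A *\<^sub>v (reflection \<alpha> *\<^sub>v y)"
    using c x y by (simp add: y_def assoc_mult_mat_vec[of _ 8 8 _ 8])
  also have "\<dots> = x - (\<alpha> \<bullet> y) \<cdot>\<^sub>v (A *\<^sub>v \<alpha>)"
    using c y \<alpha> by (simp add: reflection_mult_vec mult_minus_distrib_mat_vec[of _ 8 8] mult_mat_vec[of _ 8 8] Ay)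
  also have "\<alpha> \<bullet> y = (A *\<^sub>v \<alpha>) \<bullet> x"
    using WE8_scalar_prod[OF A \<alpha> y] by (simp add: Ay)
  finally show "A * reflection \<alpha> * transpose_mat A *\<^sub>v x = reflection (A *\<^sub>v \<alpha>) *\<^sub>v x"
    using c x \<alpha> by (simp add: reflection_mult_vec mult_mat_vec_carrier[of _ 8 8])
qed (use WE8_D(1)[OF A] in auto)

text \<open>The hypothesis asks only for \<open>S\<close> inside the group generated by
  \<open>T\<close>, so that it applies to reflections, which are words in the generators.\<close>

lemma gen_group_mono: "S \<subseteq> gen_group T \<Longrightarrow> gen_group S \<subseteq> gen_group T"
proof
  fix A assume S: "S \<subseteq> gen_group T" and "A \<in> gen_group S"
  from this(2) show "A \<in> gen_group T"
    by induction (use S in \<open>auto intro: gen_group.intros\<close>)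
qed

text \<open>A generator is its own transpose, so conjugating by it stays inside the generated
  group.\<close>

lemma reflection_orbit:
  assumes "A \<in> Sigma0" "\<alpha> \<in> carrier_vec 8" "reflection \<alpha> \<in> gen_group Sigma0"
  shows "reflection (A *\<^sub>v \<alpha>) \<in> gen_group Sigma0"
proof -
  have "A \<in> WE8" using assms Sigma0_subset_WE8 by auto
  from reflection_conjugate[OF this assms(2)]
  have "reflection (A *\<^sub>v \<alpha>) = A * reflection \<alpha> * A"
    using Sigma0_symmetric[OF assms(1)] by simp
  then show ?thesis using assms by (auto intro: gen_group.intros)
qed

lemma reflection_orbit_vec8:
  assumes "reflection (vec8 a b c d e f g h) \<in> gen_group Sigma0"
  shows reflection_orbit_X0: "reflection (vec8 e f g h a b c d) \<in> gen_group Sigma0"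
    and reflection_orbit_CX01: "reflection (vec8 a b c d g h e f) \<in> gen_group Sigma0"
    and reflection_orbit_CCX12: "reflection (vec8 a b c h e f g d) \<in> gen_group Sigma0"
    and reflection_orbit_K12:
      "reflection (vec8 ((a + b + c + d) / 2) ((a - b + c - d) / 2) ((a + b - c - d) / 2) ((a - b - c + d) / 2)
       ((e + f + g + h) / 2) ((e - f + g - h) / 2) ((e + f - g - h) / 2) ((e - f - g + h) / 2)) \<in> gen_group Sigma0"
    and reflection_orbit_uminus:
      "reflection (vec8 (-a) (-b) (-c) (-d) (-e) (-f) (-g) (-h)) \<in> gen_group Sigma0"
proof -
  note orbit = reflection_orbit[OF _ vec8_carrier assms]
  show "reflection (vec8 e f g h a b c d) \<in> gen_group Sigma0"
    using orbit[of X0] by (simp add: Sigma0_def X0_mult_vec8)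
  show "reflection (vec8 a b c d g h e f) \<in> gen_group Sigma0"
    using orbit[of CX01] by (simp add: Sigma0_def CX01_mult_vec8)
  show "reflection (vec8 a b c h e f g d) \<in> gen_group Sigma0"
    using orbit[of CCX12] by (simp add: Sigma0_def CCX12_mult_vec8)
  show "reflection (vec8 ((a + b + c + d) / 2) ((a - b + c - d) / 2) ((a + b - c - d) / 2) ((a - b - c + d) / 2)
       ((e + f + g + h) / 2) ((e - f + g - h) / 2) ((e + f - g - h) / 2) ((e - f - g + h) / 2)) \<in> gen_group Sigma0"
    using orbit[of K12] by (simp add: Sigma0_def K12_mult_vec8)
  have "vec8 (-a) (-b) (-c) (-d) (-e) (-f) (-g) (-h) = - vec8 a b c d e f g h"
    by (rule eq_vec8I) simp_all
  then show "reflection (vec8 (-a) (-b) (-c) (-d) (-e) (-f) (-g) (-h)) \<in> gen_group Sigma0"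
    using assms by (simp add: reflection_uminus)
qed

section \<open>From the root of \<open>CCX12\<close> to the simple roots\<close>

lemma CCX12_reflection: "CCX12 = reflection (vec8 0 0 0 1 0 0 0 (-1))"
proof (rule eq_mat8_on_vecI)
  fix v :: "real vec" assume v: "v \<in> carrier_vec 8"
  have "CCX12 *\<^sub>v vec8 a b c d e f g h = reflection (vec8 0 0 0 1 0 0 0 (-1)) *\<^sub>v vec8 a b c d e f g h"
    for a b c d e f g h
    by (rule eq_vec8I)
      (simp_all add: CCX12_mult_vec8 reflection_mult_vec scalar_prod_8)
  then show "CCX12 *\<^sub>v v = reflection (vec8 0 0 0 1 0 0 0 (-1)) *\<^sub>v v"
    using vec8_expand[OF v] by metis
qed auto

text \<open>A simple system of type D7 on coordinates 0 to 6. All these roots are orthogonal to e_7,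
  so their reflections can be applied after e_7 has been fixed.\<close>

definition D7_simple_roots :: "real vec set" where
  "D7_simple_roots = {vec8 1 1 0 0 0 0 0 0, vec8 (-1) 1 0 0 0 0 0 0, vec8 0 (-1) 1 0 0 0 0 0,
     vec8 0 0 (-1) 1 0 0 0 0, vec8 0 0 0 (-1) 1 0 0 0, vec8 0 0 0 0 (-1) 1 0 0,
     vec8 0 0 0 0 0 (-1) 1 0}"

text \<open>Bourbaki's simple system of type E8, with coordinates numbered from 0. The added root is
  the only one with a nonzero coordinate 7.\<close>

definition E8_simple_roots :: "real vec set" where
  "E8_simple_roots = insert (vec8 (1/2) (-1/2) (-1/2) (-1/2) (-1/2) (-1/2) (-1/2) (1/2)) D7_simple_roots"

text \<open>An explicit walk through the orbit of e_3 - e_7: each root arises from an earlier one by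
  applying a single generator. Up to sign the simple roots are those of \<open>r9\<close>,
  \<open>r10\<close>, \<open>r14\<close>, \<open>r15\<close>, \<open>r17\<close>,
  \<open>r20\<close>, \<open>r22\<close> and \<open>r23\<close>.\<close>

lemma E8_reflections_generated:
  assumes "\<alpha> \<in> E8_simple_roots"
  shows "reflection \<alpha> \<in> gen_group Sigma0"
proof -
  let ?R = "\<lambda>a b c d e f g h. reflection (vec8 a b c d e f g h) \<in> gen_group Sigma0"
  have r0: "?R 0 0 0 1 0 0 0 (-1)"
    unfolding CCX12_reflection[symmetric] by (auto simp: Sigma0_def intro: gen_group.intros)
  have r1: "?R 0 0 0 1 0 (-1) 0 0"
    using reflection_orbit_CX01[OF r0] by simp
  have r2: "?R (1/2) (-1/2) (-1/2) (1/2) (-1/2) (1/2) (1/2) (-1/2)"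
    using reflection_orbit_K12[OF r0] by simp
  have r3: "?R 0 (-1) 0 0 0 0 0 1"
    using reflection_orbit_X0[OF r1] by simp
  have r4: "?R 0 0 0 0 0 (-1) 0 1"
    using reflection_orbit_CCX12[OF r1] by simp
  have r5: "?R (1/2) (-1/2) (-1/2) (-1/2) (-1/2) (1/2) (1/2) (1/2)"
    using reflection_orbit_CCX12[OF r2] by simp
  have r6: "?R 0 (-1) 0 1 0 0 0 0"
    using reflection_orbit_CCX12[OF r3] by simp
  have r7: "?R 0 0 0 0 0 0 (-1) 1"
    using reflection_orbit_K12[OF r4] by simp
  have r8: "?R (1/2) (-1/2) (-1/2) (-1/2) (1/2) (1/2) (-1/2) (1/2)"
    using reflection_orbit_CX01[OF r5] by simp
  have r9: "?R 0 0 (-1) 1 0 0 0 0"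
    using reflection_orbit_K12[OF r6] by simp
  have r10: "?R 0 0 0 0 (-1) 1 0 0"
    using reflection_orbit_CX01[OF r7] by simp
  have r11: "?R 0 0 0 1 0 0 (-1) 0"
    using reflection_orbit_CCX12[OF r7] by simp
  have r12: "?R (1/2) (-1/2) (-1/2) (1/2) (1/2) (1/2) (-1/2) (-1/2)"
    using reflection_orbit_CCX12[OF r8] by simp
  have r13: "?R (-1/2) (1/2) (1/2) (1/2) (1/2) (-1/2) (1/2) (1/2)"
    using reflection_orbit_K12[OF r8] by simp
  have r14: "?R (-1) 1 0 0 0 0 0 0"
    using reflection_orbit_X0[OF r10] by simp
  have r15: "?R 0 0 0 1 (-1) 0 0 0"
    using reflection_orbit_CX01[OF r11] by simp
  have r16: "?R 0 0 0 1 0 0 1 0"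
    using reflection_orbit_K12[OF r12] by simp
  have r17: "?R (-1/2) (1/2) (1/2) (1/2) (1/2) (1/2) (1/2) (-1/2)"
    using reflection_orbit_CX01[OF r13] by simp
  have r18: "?R 0 0 0 0 (-1) 0 0 1"
    using reflection_orbit_CCX12[OF r15] by simp
  have r19: "?R 0 0 0 0 0 0 1 1"
    using reflection_orbit_CCX12[OF r16] by simp
  have r20: "?R 0 0 0 0 0 1 (-1) 0"
    using reflection_orbit_CX01[OF r18] by simp
  have r21: "?R 0 0 0 0 1 1 0 0"
    using reflection_orbit_CX01[OF r19] by simp
  have r22: "?R 0 1 (-1) 0 0 0 0 0"
    using reflection_orbit_X0[OF r20] by simp
  have r23: "?R 1 1 0 0 0 0 0 0"
    using reflection_orbit_X0[OF r21] by simp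
  \<comment> \<open>Four of the simple roots were reached with the opposite sign; a root and its
    negative have the same reflection.\<close>
  have "?R (1/2) (-1/2) (-1/2) (-1/2) (-1/2) (-1/2) (-1/2) (1/2)"
    using reflection_orbit_uminus[OF r17] by simp
  moreover have "?R 0 (-1) 1 0 0 0 0 0" using reflection_orbit_uminus[OF r22] by simp
  moreover have "?R 0 0 0 (-1) 1 0 0 0" using reflection_orbit_uminus[OF r15] by simp
  moreover have "?R 0 0 0 0 0 (-1) 1 0" using reflection_orbit_uminus[OF r20] by simp
  ultimately show ?thesis
    using assms r9 r10 r14 r23 unfolding E8_simple_roots_def D7_simple_roots_def by blast
qed

section \<open>The dominant chamber\<close>

text \<open>The sum of the fundamental weights: it pairs to 1 with every simple root.\<close>
definition weyl_vector :: "real vec" where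
  "weyl_vector = vec8 0 1 2 3 4 5 6 23"

lemma weyl_vector_carrier [simp]: "weyl_vector \<in> carrier_vec 8"
  by (simp add: weyl_vector_def)

lemma weyl_vector_Gamma8: "weyl_vector \<in> Gamma8"
  unfolding weyl_vector_def vec8_in_Gamma8_iff by (auto intro: exI[of _ 22])

lemma E8_simple_roots_carrier: "\<alpha> \<in> E8_simple_roots \<Longrightarrow> \<alpha> \<in> carrier_vec 8"
  by (auto simp: E8_simple_roots_def D7_simple_roots_def)

lemma weyl_vector_pairing: "\<alpha> \<in> E8_simple_roots \<Longrightarrow> weyl_vector \<bullet> \<alpha> = 1"
  unfolding E8_simple_roots_def D7_simple_roots_def weyl_vector_def
  by (elim insertE emptyE) (simp_all add: scalar_prod_8)

lemma E8_simple_roots_Gamma8: "\<alpha> \<in> E8_simple_roots \<Longrightarrow> \<alpha> \<in> Gamma8"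
proof -
  \<comment> \<open>The coordinate sums that occur: 0 for the differences, 2 for e_0 + e_1, and -2
    for the half-integral root.\<close>
  have *: "\<exists>k::int. x = 2 * of_int k" if "x = 0 \<or> x = 2 \<or> x = -2" for x :: real
    using that by (auto intro: exI[of _ 0] exI[of _ 1] exI[of _ "-1"])
  show "\<alpha> \<in> E8_simple_roots \<Longrightarrow> \<alpha> \<in> Gamma8"
    unfolding E8_simple_roots_def D7_simple_roots_def
    by (elim insertE emptyE; hypsubst; unfold vec8_in_Gamma8_iff; intro conjI *; simp)
qed

lemma E8_reflections_WE8: "\<alpha> \<in> E8_simple_roots \<Longrightarrow> reflection \<alpha> \<in> WE8"
  using E8_reflections_generated gen_group_Sigma0_subset_WE8 by auto

text \<open>A reflection in a root that pairs negatively with \<open>z\<close> brings \<open>z\<close> closer to the Weyl vector: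
  the squared distance drops by at least 2.\<close>
lemma dominant_representative:
  assumes R: "R \<subseteq> E8_simple_roots" and z: "z \<in> Gamma8"
  shows "\<exists>A \<in> gen_group (reflection ` R). \<forall>\<alpha> \<in> R. 0 \<le> \<alpha> \<bullet> (A *\<^sub>v z)"
proof -
  let ?\<rho> = weyl_vector
  have "\<exists>A \<in> gen_group (reflection ` R). \<forall>\<alpha> \<in> R. 0 \<le> \<alpha> \<bullet> (A *\<^sub>v z)"
    if "z \<in> Gamma8" "z \<bullet> z + ?\<rho> \<bullet> ?\<rho> - 2 * (?\<rho> \<bullet> z) \<le> real n" for n z
    using that
  \<comment> \<open>The bounded expression is the squared distance from \<open>z\<close> to the Weyl
    vector; a natural number above it serves as the induction measure.\<close>
  proof (induction n arbitrary: z rule: less_induct)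
    case (less n)
    note z = Gamma8_carrier[OF less.prems(1)]
    show ?case
    proof (cases "\<forall>\<alpha> \<in> R. 0 \<le> \<alpha> \<bullet> z")
      case True
      then show ?thesis using z by (intro bexI[of _ "1\<^sub>m 8"]) (auto intro: gen_group.intros)
    next
      case False
      then obtain \<alpha> where \<alpha>: "\<alpha> \<in> R" "\<alpha> \<bullet> z < 0" by auto
      then have \<alpha>R: "\<alpha> \<in> E8_simple_roots" using R by auto
      note c = E8_simple_roots_carrier[OF \<alpha>R]
      define s where "s = \<alpha> \<bullet> z"
      have "s \<in> \<int>" unfolding s_def
        by (rule Gamma8_scalar_prod_Ints[OF E8_simple_roots_Gamma8[OF \<alpha>R] less.prems(1)])
      \<comment> \<open>Integrality of the lattice turns a negative pairing into one that is at most
        -1, which bounds the gain from below.\<close>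
      with \<alpha>(2) have s: "s \<le> - 1"
        unfolding s_def[symmetric] by (auto elim!: Ints_cases)
      define z' where "z' = reflection \<alpha> *\<^sub>v z"
      have z': "z' = z - s \<cdot>\<^sub>v \<alpha>" using c z by (simp add: z'_def reflection_mult_vec s_def)
      have z'G: "z' \<in> Gamma8"
        unfolding z'_def by (rule WE8_preserves_Gamma8[OF E8_reflections_WE8[OF \<alpha>R] less.prems(1)])
      note z'c = Gamma8_carrier[OF z'G]
      have norm: "z' \<bullet> z' = z \<bullet> z"
        unfolding z'_def by (rule WE8_scalar_prod[OF E8_reflections_WE8[OF \<alpha>R] z z])
      have "?\<rho> \<bullet> z' = ?\<rho> \<bullet> z - s * (?\<rho> \<bullet> \<alpha>)"
        using c z by (simp add: z' scalar_prod_minus_distrib[of _ 8])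
      also have "\<dots> = ?\<rho> \<bullet> z - s" by (simp add: weyl_vector_pairing[OF \<alpha>R])
      finally have \<rho>: "?\<rho> \<bullet> z' \<ge> ?\<rho> \<bullet> z + 1" using s by simp
      have "0 \<le> (\<Sum>i<8. (z' $ i - ?\<rho> $ i)\<^sup>2)" by (rule sum_nonneg) simp
      also have "\<dots> = z' \<bullet> z' + ?\<rho> \<bullet> ?\<rho> - 2 * (?\<rho> \<bullet> z')"
        unfolding scalar_prod_8[OF z'c] scalar_prod_8[OF weyl_vector_carrier] sum_less_8
        by (simp add: power2_eq_square algebra_simps)
      finally have pos: "0 \<le> z' \<bullet> z' + ?\<rho> \<bullet> ?\<rho> - 2 * (?\<rho> \<bullet> z')" .
      \<comment> \<open>The new squared distance is nonnegative and smaller by at least 2, so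
        \<open>n - 2\<close> is a true subtraction and bounds it.\<close>
      with less.prems(2) \<rho> norm have n: "2 \<le> real n" by simp
      have "\<exists>A \<in> gen_group (reflection ` R). \<forall>\<alpha> \<in> R. 0 \<le> \<alpha> \<bullet> (A *\<^sub>v z')"
        using n less.prems(2) \<rho> norm by (intro less.IH[of "n - 2"] z'G) (auto simp: of_nat_diff)
      then obtain A where A: "A \<in> gen_group (reflection ` R)" "\<forall>\<alpha> \<in> R. 0 \<le> \<alpha> \<bullet> (A *\<^sub>v z')" by auto
      have "reflection ` R \<subseteq> gen_group Sigma0" using R E8_reflections_generated by auto
      then have "A \<in> WE8" using A(1) gen_group_mono gen_group_Sigma0_subset_WE8 by blast
      then have "A * reflection \<alpha> *\<^sub>v z = A *\<^sub>v z'"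
        using z WE8_D(1) by (simp add: z'_def assoc_mult_mat_vec[of _ 8 8 _ 8])
      then show ?thesis using A \<alpha>(1)
        by (intro bexI[of _ "A * reflection \<alpha>"]) (auto intro: gen_group.gen_mult gen_group.gen_base)
    qed
  qed
  moreover obtain n where "z \<bullet> z + ?\<rho> \<bullet> ?\<rho> - 2 * (?\<rho> \<bullet> z) \<le> real n"
    using real_arch_simple by blast
  ultimately show ?thesis using z by blast
qed

section \<open>Dominant lattice vectors of squared length 4\<close>

lemma dominant_E8_D:
  assumes "v \<in> carrier_vec 8" "\<And>\<alpha>. \<alpha> \<in> E8_simple_roots \<Longrightarrow> 0 \<le> \<alpha> \<bullet> v"
  shows "v $ 1 + v $ 2 + v $ 3 + v $ 4 + v $ 5 + v $ 6 \<le> v $ 0 + v $ 7"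
  using assms(2)[of "vec8 (1/2) (-1/2) (-1/2) (-1/2) (-1/2) (-1/2) (-1/2) (1/2)"] assms(1)
  by (simp add: E8_simple_roots_def scalar_prod_8)

lemma dominant_D7_D:
  assumes v: "v \<in> carrier_vec 8" and dom: "\<And>\<alpha>. \<alpha> \<in> D7_simple_roots \<Longrightarrow> 0 \<le> \<alpha> \<bullet> v"
  shows "- (v $ 0) \<le> v $ 1" "v $ 0 \<le> v $ 1" "v $ 1 \<le> v $ 2" "v $ 2 \<le> v $ 3" "v $ 3 \<le> v $ 4"
    "v $ 4 \<le> v $ 5" "v $ 5 \<le> v $ 6"
  using dom[of "vec8 1 1 0 0 0 0 0 0"] dom[of "vec8 (-1) 1 0 0 0 0 0 0"]
    dom[of "vec8 0 (-1) 1 0 0 0 0 0"] dom[of "vec8 0 0 (-1) 1 0 0 0 0"]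
    dom[of "vec8 0 0 0 (-1) 1 0 0 0"] dom[of "vec8 0 0 0 0 (-1) 1 0 0"]
    dom[of "vec8 0 0 0 0 0 (-1) 1 0"] v
  by (simp_all add: D7_simple_roots_def scalar_prod_8)

lemma Ints_ge_half:
  fixes x :: real
  assumes "x - 1/2 \<in> \<int>" "0 \<le> x"
  shows "1/2 \<le> x"
proof -
  obtain n :: int where n: "x - 1/2 = of_int n" using assms(1) by (auto elim: Ints_cases)
  with assms(2) have "(-1::real) < of_int n" by linarith
  then have "0 \<le> n" by linarith
  with n show ?thesis by (metis diff_ge_0_iff_ge of_int_0_le_iff)
qed

text \<open>The inequalities give 0 \<le> b \<le> ... \<le> g and c + d + e + f + g \<le> h, while
  the norm forces h \<le> 2. For h = 0 everything vanishes, for h = 1 only g can also be nonzero and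
  the norm is at most 2, and for h = 2 the last coordinate uses up the whole norm.\<close>

lemma int_dominant_norm_4:
  fixes a b c d e f g h :: int
  assumes "- a \<le> b" "a \<le> b" "b \<le> c" "c \<le> d" "d \<le> e" "e \<le> f" "f \<le> g" "b + c + d + e + f + g \<le> a + h"
    and norm: "a * a + b * b + c * c + d * d + e * e + f * f + g * g + h * h = 4"
  shows "a = 0 \<and> b = 0 \<and> c = 0 \<and> d = 0 \<and> e = 0 \<and> f = 0 \<and> g = 0 \<and> h = 2"
proof -
  have nn: "0 \<le> a * a" "0 \<le> b * b" "0 \<le> c * c" "0 \<le> d * d" "0 \<le> e * e" "0 \<le> f * f" "0 \<le> g * g"
    by simp_all
  have "h < 3"
  proof (rule ccontr)
    assume "\<not> h < 3"
    then have "3 * 3 \<le> h * h" by (intro mult_mono) auto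
    with nn norm show False by linarith
  qed
  moreover have "0 \<le> h" using assms by linarith
  ultimately consider "h = 0" | "h = 1" | "h = 2" by linarith
  then show ?thesis
  proof cases
    case 1
    then have "a = 0 \<and> b = 0 \<and> c = 0 \<and> d = 0 \<and> e = 0 \<and> f = 0 \<and> g = 0" using assms(1-8) by linarith
    with norm 1 show ?thesis by simp
  next
    case 2
    \<comment> \<open>The nonnegative ordered integers c, ..., g have sum at most 1, so at most the
      largest one, g, is 1.\<close>
    have "0 \<le> b" "f \<le> 0" "g \<le> 1" using 2 assms(1-8) by linarith+
    then have z: "a = 0 \<and> b = 0 \<and> c = 0 \<and> d = 0 \<and> e = 0 \<and> f = 0"
      using assms(1-8) by linarith
    moreover have "g = 0 \<or> g = 1" using z \<open>f \<le> g\<close> \<open>g \<le> 1\<close> by linarith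
    ultimately show ?thesis using norm 2 by auto
  next
    case 3
    then have *: "a * a + b * b + c * c + d * d + e * e + f * f + g * g = 0" using norm by simp
    have "a * a = 0" "b * b = 0" "c * c = 0" "d * d = 0" "e * e = 0" "f * f = 0" "g * g = 0"
      using * nn by linarith+
    with 3 show ?thesis by simp
  qed
qed

text \<open>A half-integral dominant vector is too long: coordinates 1 to 6 are at least 1/2, so the
  last one is at least 5/2, whose square 25/4 exceeds 4. The integral case is a statement about
  integers after taking floors.\<close>

lemma dominant_norm_4:
  assumes v: "v \<in> Gamma8" and norm: "v \<bullet> v = 4" and dom: "\<And>\<alpha>. \<alpha> \<in> E8_simple_roots \<Longrightarrow> 0 \<le> \<alpha> \<bullet> v"
  shows "v = vec8 0 0 0 0 0 0 0 2"
proof -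
  note c = Gamma8_carrier[OF v]
  have D: "D7_simple_roots \<subseteq> E8_simple_roots" by (auto simp: E8_simple_roots_def)
  note ineqs = dominant_D7_D[OF c dom[OF subsetD[OF D]]] dominant_E8_D[OF c dom]
  note norm = norm[unfolded scalar_prod_8[OF c]]
  show ?thesis
  proof (cases "\<forall>i<8. v $ i \<in> \<int>")
    case True
    define w where "w i = \<lfloor>v $ i\<rfloor>" for i
    have w: "v $ i = of_int (w i)" if "i < 8" for i using True that by (simp add: w_def)
    have "w 0 = 0 \<and> w 1 = 0 \<and> w 2 = 0 \<and> w 3 = 0 \<and> w 4 = 0 \<and> w 5 = 0 \<and> w 6 = 0 \<and> w 7 = 2"
    proof (rule int_dominant_norm_4)
      show "w 0 * w 0 + w 1 * w 1 + w 2 * w 2 + w 3 * w 3 + w 4 * w 4 + w 5 * w 5 + w 6 * w 6 + w 7 * w 7 = 4"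
        using norm by (simp add: w flip: of_int_mult of_int_add)
    qed (use ineqs in \<open>simp_all add: w flip: of_int_add of_int_minus\<close>)
    then show ?thesis using c by (intro eq_vec8I) (simp_all add: w)
  next
    case False
    with v have half: "v $ i - 1/2 \<in> \<int>" if "i < 8" for i using that by (auto simp: Gamma8_def)
    have "1/2 \<le> v $ 1" by (rule Ints_ge_half) (use half ineqs in auto)
    with ineqs have "5/2 \<le> v $ 7" by linarith
    then have "5/2 * (5/2) \<le> v $ 7 * v $ 7" by (intro mult_mono) auto
    moreover have "0 \<le> v $ i * v $ i" for i by simp
    from this[of 0] this[of 1] this[of 2] this[of 3] this[of 4] this[of 5] this[of 6]
    have "v $ 7 * v $ 7 \<le> 4" using norm by linarith
    ultimately show ?thesis by simp
  qed
qed

section \<open>Generation\<close>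

text \<open>Serves twice: to keep e_7 fixed by products of D7 reflections, and to separate a
  generator from the other three.\<close>

lemma gen_group_fixes:
  assumes S: "\<And>A. A \<in> S \<Longrightarrow> A \<in> carrier_mat 8 8 \<and> A *\<^sub>v w = w" and w: "w \<in> carrier_vec 8"
    and M: "M \<in> gen_group S"
  shows "M \<in> carrier_mat 8 8 \<and> M *\<^sub>v w = w"
  using M
proof induction
  case (gen_inv A B)
  then have "B *\<^sub>v (A *\<^sub>v w) = B * A *\<^sub>v w"
    using w by (intro assoc_mult_mat_vec[symmetric]) auto
  also have "\<dots> = w" using gen_inv w by simp
  finally have "B *\<^sub>v (A *\<^sub>v w) = w" .
  then show ?case using gen_inv by simp
qed (use S w in \<open>auto simp: assoc_mult_mat_vec[of _ 8 8 _ 8]\<close>)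

lemma WE8_fixing_unit_vec_7_Ints:
  assumes N: "N \<in> WE8" and fix7: "N *\<^sub>v unit_vec 8 7 = unit_vec 8 7" and ij: "i < 8" "j < 8"
  shows "N $$ (i, j) \<in> \<int>"
proof (cases "j = 7")
  case True
  have "N $$ (i, 7) = (N *\<^sub>v unit_vec 8 7) $ i" using WE8_D(1)[OF N] ij by simp
  also have "\<dots> \<in> \<int>" using fix7 ij by (simp add: unit_vec_def)
  finally show ?thesis using True by simp
next
  case False
  note c = WE8_D(1)[OF N]
  define u where "u = unit_vec 8 j - (unit_vec 8 7 :: real vec)"
  have "u \<in> Gamma8"
    using ij False by (auto simp: u_def Gamma8_def unit_vec_def sum_subtractf intro: exI[of _ 0])
  then have G: "N *\<^sub>v u \<in> Gamma8" by (rule WE8_preserves_Gamma8[OF N])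
  have Nu: "(N *\<^sub>v u) $ k = N $$ (k, j) - unit_vec 8 7 $ k" if "k < 8" for k
    using c ij that by (simp add: u_def mult_minus_distrib_mat_vec[of _ 8 8] fix7)
  \<comment> \<open>Row 7 vanishes off the diagonal because N preserves the orthogonality of e_7 and
    e_j and fixes e_7. So the last coordinate of N u is the integer -1, which rules out the
    half-integral coset.\<close>
  have "N $$ (7, j) = unit_vec 8 7 \<bullet> (N *\<^sub>v unit_vec 8 j)"
    using c ij by simp
  also have "\<dots> = (N *\<^sub>v unit_vec 8 7) \<bullet> (N *\<^sub>v unit_vec 8 j)" by (simp add: fix7)
  also have "\<dots> = 0" using ij False by (simp add: WE8_scalar_prod[OF N])
  finally have "(N *\<^sub>v u) $ 7 = - 1" using Nu[of 7] by simp
  moreover have "- 1 - 1/2 \<notin> (\<int> :: real set)"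
  proof
    assume "- 1 - 1/2 \<in> (\<int> :: real set)"
    then obtain n :: int where "- 1 - 1/2 = (of_int n :: real)" by (auto elim: Ints_cases)
    then have "of_int (2 * n) = (of_int (-3) :: real)" by simp
    then have "2 * n = -3" by (simp only: of_int_eq_iff)
    then show False by presburger
  qed
  ultimately have "\<not> (N *\<^sub>v u) $ 7 - 1/2 \<in> \<int>" by simp
  then have "\<not> (\<forall>i<8. (N *\<^sub>v u) $ i - 1/2 \<in> \<int>)" unfolding all_less_8 by blast
  then have "(N *\<^sub>v u) $ i \<in> \<int>" using G ij unfolding Gamma8_def by blast
  then have "(N *\<^sub>v u) $ i + unit_vec 8 7 $ i \<in> \<int>"
    by (intro Ints_add) (use ij in \<open>auto simp: unit_vec_def\<close>)
  then show ?thesis using Nu[OF ij(1)] by simp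
qed

text \<open>A nonzero integer has square at least 1, so a single nonzero entry already exhausts the
  sum.\<close>

lemma integral_unit_row:
  fixes f :: "nat \<Rightarrow> real"
  assumes f: "\<And>j. j < n \<Longrightarrow> f j \<in> \<int>" and norm: "(\<Sum>j<n. f j * f j) = 1"
  shows "\<exists>p<n. \<bar>f p\<bar> = 1 \<and> (\<forall>j<n. j \<noteq> p \<longrightarrow> f j = 0)"
proof -
  have "\<not> (\<forall>j<n. f j = 0)"
  proof
    assume "\<forall>j<n. f j = 0"
    then have "(\<Sum>j<n. f j * f j) = 0" by (intro sum.neutral) auto
    with norm show False by simp
  qed
  then obtain p where p: "p < n" "f p \<noteq> 0" by auto
  have split: "(\<Sum>j<n. f j * f j) = f p * f p + (\<Sum>j\<in>{..<n} - {p}. f j * f j)"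
    using p by (simp add: sum.remove)
  have ge: "1 \<le> \<bar>f p\<bar>" by (rule Ints_nonzero_abs_ge1) (use f p in auto)
  then have "1 * 1 \<le> \<bar>f p\<bar> * \<bar>f p\<bar>" by (intro mult_mono) auto
  then have sq: "1 \<le> f p * f p" by simp
  have nn: "0 \<le> (\<Sum>j\<in>{..<n} - {p}. f j * f j)" by (rule sum_nonneg) simp
  with split norm sq have "(\<Sum>j\<in>{..<n} - {p}. f j * f j) = 0" "f p * f p = 1" by linarith+
  then have "\<forall>j\<in>{..<n} - {p}. f j * f j = 0" by (subst (asm) sum_nonneg_eq_0_iff) auto
  moreover have "\<bar>f p\<bar> = 1" using \<open>f p * f p = 1\<close> by (auto simp: square_eq_1_iff)
  ultimately show ?thesis using p by auto
qed

text \<open>The first seven coordinates 0, ..., 6 of the Weyl vector have distinct absolute values.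
  So the image under a signed permutation reveals the permutation through absolute values, and all
  signs except the one attached to the coordinate 0.\<close>

lemma WE8_eq_one:
  assumes N: "N \<in> WE8" and fix7: "N *\<^sub>v unit_vec 8 7 = unit_vec 8 7"
    and dom: "\<And>\<alpha>. \<alpha> \<in> D7_simple_roots \<Longrightarrow> 0 \<le> \<alpha> \<bullet> (N *\<^sub>v weyl_vector)"
  shows "N = 1\<^sub>m 8"
proof -
  note c = WE8_D(1)[OF N]
  define x where "x = N *\<^sub>v weyl_vector"
  have "x \<in> carrier_vec 8" unfolding x_def using c weyl_vector_carrier by (rule mult_mat_vec_carrier)
  note ineqs = dominant_D7_D[OF this dom[folded x_def]]
  \<comment> \<open>The diagonal case makes each row a signed unit vector; the off-diagonal case
    makes their positions \<open>p i\<close> distinct.\<close>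
  have rows: "(\<Sum>j<8. N $$ (i, j) * N $$ (k, j)) = (if i = k then 1 else 0)" if "i < 8" "k < 8" for i k
  proof -
    have "(N * transpose_mat N) $$ (i, k) = (if i = k then 1 else 0)" using that by (simp add: WE8_D(2)[OF N])
    then show ?thesis using c that by (simp add: scalar_prod_def lessThan_atLeast0)
  qed
  have "\<exists>p<8. \<bar>N $$ (i, p)\<bar> = 1 \<and> (\<forall>j<8. j \<noteq> p \<longrightarrow> N $$ (i, j) = 0)" if "i < 8" for i
    using WE8_fixing_unit_vec_7_Ints[OF N fix7 that] rows[OF that that] by (intro integral_unit_row) auto
  then obtain p where p: "\<And>i. i < 8 \<Longrightarrow> p i < 8" "\<And>i. i < 8 \<Longrightarrow> \<bar>N $$ (i, p i)\<bar> = 1"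
      "\<And>i j. i < 8 \<Longrightarrow> j < 8 \<Longrightarrow> j \<noteq> p i \<Longrightarrow> N $$ (i, j) = 0"
    by metis
  have row: "(\<Sum>j<8. N $$ (i, j) * y j) = N $$ (i, p i) * y (p i)" if "i < 8" for i y
  proof -
    have "(\<Sum>j<8. N $$ (i, j) * y j) = (\<Sum>j\<in>{p i}. N $$ (i, j) * y j)"
      by (rule sum.mono_neutral_right) (use p that in auto)
    then show ?thesis by simp
  qed
  have inj: "p i \<noteq> p k" if "i < 8" "k < 8" "i \<noteq> k" for i k
  proof
    assume eq: "p i = p k"
    have "N $$ (i, p i) * N $$ (k, p i) = 0"
      using rows[OF that(1,2)] row[OF that(1), of "\<lambda>j. N $$ (k, j)"] that by simp
    then show False using p(2)[OF that(1)] p(2)[OF that(2)] eq by auto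
  qed
  have "N $$ (7, 7) = (N *\<^sub>v unit_vec 8 7) $ 7" using c by simp
  then have N7: "N $$ (7, 7) = 1" by (simp add: fix7)
  then have p7: "p 7 = 7" using p(3)[of 7 7] by auto
  have p_less: "p i < 7" if "i < 7" for i
    using p(1)[of i] inj[of i 7] that p7 by simp
  have weyl: "weyl_vector $ i = real i" if "i < 7" for i
    using that less_8_cases[of i] unfolding weyl_vector_def by auto
  have x: "x $ i = N $$ (i, p i) * real (p i)" if "i < 7" for i
    using row[of i "\<lambda>j. weyl_vector $ j"] that p_less[OF that] c
    by (simp add: x_def scalar_prod_def lessThan_atLeast0 weyl carrier_vecD[OF weyl_vector_carrier])
  have abs_x: "\<bar>x $ i\<bar> = real (p i)" if "i < 7" for i
    using that p(2)[of i] by (simp add: x abs_mult)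
  have le: "p i \<le> p j" if "i < 7" "j < 7" "\<bar>x $ i\<bar> \<le> \<bar>x $ j\<bar>" for i j
    using that by (simp add: abs_x)
  \<comment> \<open>D7 dominance sorts the absolute values |x_0| \<le> x_1 \<le> ... \<le> x_6, and
    these are the values of \<open>p\<close>. Being strictly increasing below 7, \<open>p\<close> is
    the identity on 0, ..., 6.\<close>
  have "p 0 \<le> p 1" "p 1 \<le> p 2" "p 2 \<le> p 3" "p 3 \<le> p 4" "p 4 \<le> p 5" "p 5 \<le> p 6"
    by (rule le; use ineqs in linarith)+
  then have less: "p 0 < p 1" "p 1 < p 2" "p 2 < p 3" "p 3 < p 4" "p 4 < p 5" "p 5 < p 6"
    using inj[of 0 1] inj[of 1 2] inj[of 2 3] inj[of 3 4] inj[of 4 5] inj[of 5 6] by simp_all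
  have "p 6 < 7" by (simp add: p_less)
  with less have id: "p 0 = 0" "p 1 = 1" "p 2 = 2" "p 3 = 3" "p 4 = 4" "p 5 = 5" "p 6 = 6"
    by linarith+
  \<comment> \<open>For these indices the coordinate of \<open>x\<close> is nonnegative and equals a
    sign times the positive number i.\<close>
  have pos: "N $$ (i, i) = 1" if "i \<in> {1, 2, 3, 4, 5, 6}" for i
  proof -
    have "p i = i" "0 \<le> x $ i" "0 < i" "i < 7" using that id ineqs by auto
    then show ?thesis using x[of i] p(2)[of i] by (auto simp: abs_if zero_le_mult_iff split: if_splits)
  qed
  have N0: "N $$ (0, 0) = 1"
  proof (rule ccontr)
    assume "N $$ (0, 0) \<noteq> 1"
    then have m: "N $$ (0, 0) = - 1" using p(2)[of 0] id by (auto simp: abs_if split: if_splits)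
    \<comment> \<open>The Weyl vector is 0 at coordinate 0 and cannot detect the sign there. The
      lattice vector with all coordinates 1/2 can: flipping only that sign lowers the coordinate sum
      from 4 to 3, which is odd.\<close>
    define h where "h = vec 8 (\<lambda>i. 1/2 :: real)"
    have "h \<in> Gamma8" by (auto simp: h_def Gamma8_def intro: exI[of _ 2])
    then have G: "N *\<^sub>v h \<in> Gamma8" by (rule WE8_preserves_Gamma8[OF N])
    have "(N *\<^sub>v h) $ i = N $$ (i, p i) / 2" if "i < 8" for i
      using row[of i "\<lambda>j. h $ j"] that p(1)[OF that] c by (simp add: scalar_prod_def lessThan_atLeast0 h_def)
    then have "(\<Sum>i<8. (N *\<^sub>v h) $ i) = (\<Sum>i<8. N $$ (i, p i) / 2)" by (intro sum.cong) auto
    also have "\<dots> = 3" unfolding sum_less_8 using pos[of 1] pos[of 2] pos[of 3] pos[of 4] pos[of 5] pos[of 6]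
      by (simp add: id p7 N7 m del: One_nat_def)
    finally obtain k :: int where "3 = (2 * of_int k :: real)" using G unfolding Gamma8_def by auto
    then have "of_int 3 = (of_int (2 * k) :: real)" by simp
    then have "3 = 2 * k" by (simp only: of_int_eq_iff)
    then show False by presburger
  qed
  have "p i = i \<and> N $$ (i, i) = 1" if "i < 8" for i
    using that id p7 pos N0 N7 unfolding less_8_cases by auto
  then show ?thesis using c p(3) by (intro eq_matI) auto
qed

lemma unit_vec_8_7: "unit_vec 8 7 = vec8 0 0 0 0 0 0 0 1"
  by (rule eq_vec8I) simp_all

lemma WE8_subset_gen_group_Sigma0: "WE8 \<subseteq> gen_group Sigma0"
proof
  fix M assume M: "M \<in> WE8"
  let ?e = "unit_vec 8 7 :: real vec"
  have refl: "reflection ` E8_simple_roots \<subseteq> gen_group Sigma0" "reflection ` D7_simple_roots \<subseteq> gen_group Sigma0"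
    using E8_reflections_generated by (auto simp: E8_simple_roots_def)
  have twice: "vec8 0 0 0 0 0 0 0 2 = 2 \<cdot>\<^sub>v ?e"
    unfolding unit_vec_8_7 by (rule eq_vec8I) simp_all
  \<comment> \<open>The vector e_7 has odd coordinate sum and is not in the lattice; its double is,
    with squared length 4.\<close>
  have G: "2 \<cdot>\<^sub>v ?e \<in> Gamma8"
    unfolding twice[symmetric] vec8_in_Gamma8_iff by (auto intro: exI[of _ 1])
  obtain A where A: "A \<in> gen_group (reflection ` E8_simple_roots)"
    and A_dom: "\<And>\<alpha>. \<alpha> \<in> E8_simple_roots \<Longrightarrow> 0 \<le> \<alpha> \<bullet> (A *\<^sub>v (M *\<^sub>v (2 \<cdot>\<^sub>v ?e)))"
    using dominant_representative[OF subset_refl WE8_preserves_Gamma8[OF M G]] by auto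
  have A': "A \<in> gen_group Sigma0" using A gen_group_mono[OF refl(1)] by auto
  then have AW: "A \<in> WE8" using gen_group_Sigma0_subset_WE8 by auto
  note AM = WE8_mult[OF AW M]
  note c = WE8_D(1)[OF M] WE8_D(1)[OF AW] WE8_D(1)[OF AM]
  have AMe: "A *\<^sub>v (M *\<^sub>v (2 \<cdot>\<^sub>v ?e)) = A * M *\<^sub>v (2 \<cdot>\<^sub>v ?e)"
    using c by (simp add: assoc_mult_mat_vec[of _ 8 8 _ 8])
  have "A * M *\<^sub>v (2 \<cdot>\<^sub>v ?e) = vec8 0 0 0 0 0 0 0 2"
  proof (rule dominant_norm_4)
    show "A * M *\<^sub>v (2 \<cdot>\<^sub>v ?e) \<in> Gamma8" by (rule WE8_preserves_Gamma8[OF AM G])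
    show "(A * M *\<^sub>v (2 \<cdot>\<^sub>v ?e)) \<bullet> (A * M *\<^sub>v (2 \<cdot>\<^sub>v ?e)) = 4"
      by (subst WE8_scalar_prod[OF AM]) simp_all
  qed (use A_dom in \<open>simp add: AMe\<close>)
  then have "2 \<cdot>\<^sub>v (A * M *\<^sub>v ?e) = 2 \<cdot>\<^sub>v ?e"
    unfolding twice using c(3) by (simp add: mult_mat_vec[of _ 8 8])
  then have AM_fix: "A * M *\<^sub>v ?e = ?e"
    using c(3) by (auto simp: vec_eq_iff simp del: index_mult_mat_vec)
  \<comment> \<open>The second correction uses only D7 reflections, so it does not disturb
    e_7.\<close>
  obtain B where B: "B \<in> gen_group (reflection ` D7_simple_roots)"
    and B_dom: "\<And>\<alpha>. \<alpha> \<in> D7_simple_roots \<Longrightarrow> 0 \<le> \<alpha> \<bullet> (B *\<^sub>v (A * M *\<^sub>v weyl_vector))"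
    using dominant_representative[of D7_simple_roots, OF _ WE8_preserves_Gamma8[OF AM weyl_vector_Gamma8]]
    by (auto simp: E8_simple_roots_def)
  have B': "B \<in> gen_group Sigma0" using B gen_group_mono[OF refl(2)] by auto
  then have BW: "B \<in> WE8" using gen_group_Sigma0_subset_WE8 by auto
  note Bc = WE8_D(1)[OF BW]
  have "reflection \<alpha> *\<^sub>v ?e = ?e" if "\<alpha> \<in> D7_simple_roots" for \<alpha>
  proof -
    have "\<alpha> \<in> carrier_vec 8" "\<alpha> $ 7 = 0" using that unfolding D7_simple_roots_def by auto
    then show ?thesis by (intro eq_vecI) (auto simp: reflection_mult_vec)
  qed
  then have "A \<in> carrier_mat 8 8 \<and> A *\<^sub>v ?e = ?e" if "A \<in> reflection ` D7_simple_roots" for A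
    using that by auto
  from gen_group_fixes[OF this _ B] have "B *\<^sub>v ?e = ?e" by simp
  then have "B * (A * M) *\<^sub>v ?e = ?e"
    using Bc c(3) AM_fix by (simp add: assoc_mult_mat_vec[of _ 8 8 _ 8])
  moreover have "B *\<^sub>v (A * M *\<^sub>v weyl_vector) = B * (A * M) *\<^sub>v weyl_vector"
    using Bc c(3) by (intro assoc_mult_mat_vec[symmetric]) auto
  ultimately have "B * (A * M) = 1\<^sub>m 8"
    using B_dom by (intro WE8_eq_one WE8_mult[OF BW AM]) auto
  then have 1: "B * A * M = 1\<^sub>m 8"
    using Bc c by (simp add: assoc_mult_mat[of _ 8 8 _ 8 _ 8])
  \<comment> \<open>The left inverse is the transpose of M, hence two-sided, so M is itself the
    inverse of the generated element B A.\<close>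
  then have "B * A = transpose_mat M"
    using Bc c by (intro WE8_inverse[OF M]) auto
  then have 2: "M * (B * A) = 1\<^sub>m 8" using WE8_D(2)[OF M] by simp
  show "M \<in> gen_group Sigma0"
    using gen_group.gen_inv[OF gen_group.gen_mult[OF B' A'] c(1) 1 2] .
qed

section \<open>Minimality\<close>

text \<open>Positive determinant is inherited by products and inverses, so it separates
  \<open>CCX12\<close> from the other three generators.\<close>

lemma gen_group_det_pos:
  assumes S: "\<And>A. A \<in> S \<Longrightarrow> A \<in> carrier_mat 8 8 \<and> 0 < det A" and M: "M \<in> gen_group S"
  shows "M \<in> carrier_mat 8 8 \<and> 0 < det M"
  using M
proof induction
  case (gen_mult A B)
  then show ?case by (auto simp: det_mult[of _ 8])
next
  case (gen_inv A B)
  then have "det A * det B = 1" by (metis det_mult det_one)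
  then show ?case using gen_inv zero_less_mult_pos[of "det A" "det B"] by simp
qed (use S in auto)

text \<open>An involution has nonzero determinant, so exhibiting the determinant as a square fixes
  its sign without evaluating it.\<close>

lemma involution_det_pos:
  fixes A :: "real mat"
  assumes "A \<in> carrier_mat n n" "A * A = 1\<^sub>m n" "det A = d * d"
  shows "0 < det A"
proof -
  have "det A * det A = 1" using det_mult[of A n A] assms by simp
  then have "det A \<noteq> 0" by auto
  then show ?thesis using assms(3) zero_le_square[of d] by linarith
qed

lemma perm_mat8_mult:
  assumes "\<And>j. j < 8 \<Longrightarrow> q j < 8"
  shows "perm_mat8 p * perm_mat8 q = perm_mat8 (\<lambda>j. p (q j))"
proof (rule eq_matI)
  fix i j assume "i < dim_row (perm_mat8 (\<lambda>j. p (q j)))" "j < dim_col (perm_mat8 (\<lambda>j. p (q j)))"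
  then have ij: "i < 8" "j < 8" by (simp_all add: perm_mat8_def)
  then have "(perm_mat8 p * perm_mat8 q) $$ (i, j) =
      (\<Sum>k = 0..<8. (if i = p k then 1 else 0) * (if k = q j then 1 else 0))"
    by (simp add: perm_mat8_def scalar_prod_def)
  also have "\<dots> = (\<Sum>k = 0..<8. if k = q j then (if i = p k then 1 else 0) else 0)"
    by (rule sum.cong) auto
  also have "\<dots> = perm_mat8 (\<lambda>j. p (q j)) $$ (i, j)"
    using ij assms[OF ij(2)] by (simp add: perm_mat8_def)
  finally show "(perm_mat8 p * perm_mat8 q) $$ (i, j) = perm_mat8 (\<lambda>j. p (q j)) $$ (i, j)" .
qed (simp_all add: perm_mat8_def)

lemma perm_mat8_carrier [simp]: "perm_mat8 p \<in> carrier_mat 8 8"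
  by (simp add: perm_mat8_def)

lemma perm_mat8_cong: "(\<And>j. j < 8 \<Longrightarrow> p j = q j) \<Longrightarrow> perm_mat8 p = perm_mat8 q"
  by (rule eq_matI) (auto simp: perm_mat8_def)

lemma det_X0_pos: "0 < det X0"
proof (rule involution_det_pos)
  \<comment> \<open>A square root of the permutation: the 4-cycles (0 1 4 5) and (2 3 6 7), whose
    squares exchange j and j + 4.\<close>
  let ?p = "\<lambda>j. [1, 4, 3, 6, 5, 0, 7, 2] ! j :: nat"
  have "?p j < 8" if "j < 8" for j using that unfolding less_8_cases by auto
  then have "perm_mat8 ?p * perm_mat8 ?p = perm_mat8 (\<lambda>j. ?p (?p j))" by (rule perm_mat8_mult)
  also have "\<dots> = X0" unfolding X0_def
    by (rule perm_mat8_cong, unfold less_8_cases, elim insertE emptyE)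
      (simp_all add: idx3_def qbit_def)
  finally show "det X0 = det (perm_mat8 ?p) * det (perm_mat8 ?p)"
    by (metis det_mult perm_mat8_carrier)
qed (simp_all add: Sigma0_involution Sigma0_def)

lemma det_CX01_pos: "0 < det CX01"
proof (rule involution_det_pos)
  \<comment> \<open>The 4-cycle (4 5 6 7), whose square exchanges 4 with 6 and 5 with 7.\<close>
  let ?p = "\<lambda>j. [0, 1, 2, 3, 5, 6, 7, 4] ! j :: nat"
  have "?p j < 8" if "j < 8" for j using that unfolding less_8_cases by auto
  then have "perm_mat8 ?p * perm_mat8 ?p = perm_mat8 (\<lambda>j. ?p (?p j))" by (rule perm_mat8_mult)
  also have "\<dots> = CX01" unfolding CX01_def
    by (rule perm_mat8_cong, unfold less_8_cases, elim insertE emptyE)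
      (simp_all add: idx3_def qbit_def)
  finally show "det CX01 = det (perm_mat8 ?p) * det (perm_mat8 ?p)"
    by (metis det_mult perm_mat8_carrier)
qed (simp_all add: Sigma0_involution Sigma0_def)

lemma det_K12_pos: "0 < det K12"
proof (rule involution_det_pos)
  \<comment> \<open>Q is H tensor H. The matrix is block diagonal with two copies of it, one for
    each value of qubit 0, so its determinant is a square.\<close>
  define Q :: "real mat" where "Q = mat 4 4 (\<lambda>(i, j). K12 $$ (i, j))"
  have Q: "Q \<in> carrier_mat 4 4" by (simp add: Q_def)
  have qbit_low: "qbit 0 i = 0" and qbit_high: "qbit 0 (i + 4) = 1" if "i < 4" for i
    using that by (simp_all add: qbit_def)
  have qbit_shift: "qbit (Suc 0) (i + 4) = qbit (Suc 0) i" "qbit 2 (i + 4) = qbit 2 i" for i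
  proof -
    have "(i + 4) div 2 = i div 2 + 2" by simp
    then show "qbit (Suc 0) (i + 4) = qbit (Suc 0) i" by (simp add: qbit_def)
    have "(i + 4) mod 2 = i mod 2" by presburger
    then show "qbit 2 (i + 4) = qbit 2 i" by (simp add: qbit_def)
  qed
  have "K12 = four_block_mat Q (0\<^sub>m 4 4) (0\<^sub>m 4 4) Q"
  proof (rule eq_matI)
    fix i j assume "i < dim_row (four_block_mat Q (0\<^sub>m 4 4) (0\<^sub>m 4 4) Q)"
      "j < dim_col (four_block_mat Q (0\<^sub>m 4 4) (0\<^sub>m 4 4) Q)"
    then have ij: "i < 8" "j < 8" using Q by simp_all
    have split: "k < 4 \<or> (\<exists>l<4. k = l + 4)" if "k < 8" for k :: nat
      using that by (cases "k < 4") (auto intro: exI[of _ "k - 4"])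
    from split[OF ij(1)] split[OF ij(2)]
    show "K12 $$ (i, j) = four_block_mat Q (0\<^sub>m 4 4) (0\<^sub>m 4 4) Q $$ (i, j)"
      using ij by (auto simp: Q_def K12_def qbit_low qbit_high qbit_shift)
  qed (use Q in \<open>auto simp: K12_def\<close>)
  then show "det K12 = det Q * det Q"
    using Q by (metis det_four_block_mat_lower_left_zero zero_carrier_mat)
qed (simp_all add: Sigma0_involution Sigma0_def)

lemma det_CCX12: "det CCX12 = - 1"
proof -
  \<comment> \<open>Qubits 1 and 2 are both 1 exactly at the indices 3 and 7, so the gate is one
    transposition.\<close>
  have "CCX12 = swaprows_mat 8 3 7"
  proof (rule eq_matI)
    fix i j :: nat assume "i < dim_row (swaprows_mat 8 3 7 :: real mat)" "j < dim_col (swaprows_mat 8 3 7 :: real mat)"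
    then have ij: "i < 8" "j < 8" by simp_all
    then have "idx3 ((qbit 0 j + qbit 1 j * qbit 2 j) mod 2) (qbit 1 j) (qbit 2 j) =
        (if j = 3 then 7 else if j = 7 then 3 else j)"
      unfolding less_8_cases by (auto simp: idx3_def qbit_def)
    then show "CCX12 $$ (i, j) = swaprows_mat 8 3 7 $$ (i, j)"
      using ij by (auto simp: CCX12_def perm_mat8_def)
  qed (simp_all add: CCX12_def perm_mat8_def)
  moreover have "det (swaprows_mat 8 3 7 :: real mat) = - 1"
    by (rule det_swaprows_mat) simp_all
  ultimately show ?thesis by metis
qed

lemma Sigma0_minimal:
  assumes A: "A \<in> Sigma0"
  shows "A \<notin> gen_group (Sigma0 - {A})"
proof
  assume G: "A \<in> gen_group (Sigma0 - {A})"
  have fixes_absurd: False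
    if "\<And>B. B \<in> Sigma0 \<Longrightarrow> B \<noteq> A \<Longrightarrow> B *\<^sub>v w = w" "w \<in> carrier_vec 8" "A *\<^sub>v w \<noteq> w" for w
  proof -
    have "B \<in> carrier_mat 8 8 \<and> B *\<^sub>v w = w" if "B \<in> Sigma0 - {A}" for B
      using that Sigma0_subset_WE8 WE8_D(1) \<open>\<And>B. B \<in> Sigma0 \<Longrightarrow> B \<noteq> A \<Longrightarrow> B *\<^sub>v w = w\<close>
      by blast
    from gen_group_fixes[OF this \<open>w \<in> carrier_vec 8\<close> G] show False using \<open>A *\<^sub>v w \<noteq> w\<close> by simp
  qed
  \<comment> \<open>In each case below the omitted generator already changes coordinate 4 or 5 of
    the chosen vector.\<close>
  have neq: "vec8 a b c d e f g h \<noteq> vec8 a' b' c' d' e' f' g' h'" if "e \<noteq> e' \<or> f \<noteq> f'"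
    for a b c d e f g h a' b' c' d' e' f' g' h'
  proof
    assume eq: "vec8 a b c d e f g h = vec8 a' b' c' d' e' f' g' h'"
    from arg_cong[OF eq, of "\<lambda>v. v $ 4"] arg_cong[OF eq, of "\<lambda>v. v $ 5"] that show False by simp
  qed
  from A consider "A = X0" | "A = CX01" | "A = CCX12" | "A = K12" by (auto simp: Sigma0_def)
  then show False
  proof cases
    case 1
    then show False
      \<comment> \<open>The vector (2, 1, 1, 0) is fixed by H tensor H. Placed in the block of qubit
        0 equal to 0, it is untouched by \<open>CX01\<close>, and its last entry 0 makes
        \<open>CCX12\<close> fix it; \<open>X0\<close> moves it to the other block.\<close>
      by (intro fixes_absurd[of "vec8 2 1 1 0 0 0 0 0"])
        (auto simp: Sigma0_def Sigma0_mult_vec8 neq)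
  next
    case 2
    then show False
      \<comment> \<open>The vector (1, 1, 1, -1) is fixed by H tensor H, and repeating it in both
        blocks makes it invariant under \<open>X0\<close> and \<open>CCX12\<close>.
        \<open>CX01\<close> moves the -1 in the second block.\<close>
      by (intro fixes_absurd[of "vec8 1 1 1 (-1) 1 1 1 (-1)"])
        (auto simp: Sigma0_def Sigma0_mult_vec8 neq)
  next
    case 3
    have "B \<in> carrier_mat 8 8 \<and> 0 < det B" if "B \<in> Sigma0 - {CCX12}" for B
      using that det_X0_pos det_CX01_pos det_K12_pos by (auto simp: Sigma0_def)
    from gen_group_det_pos[OF this] G 3 have "0 < det CCX12" by blast
    then show False by (simp add: det_CCX12)
  next
    case 4
    then show False
      \<comment> \<open>Every permutation matrix fixes the constant vector, while \<open>K12\<close>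
        sends it to 2 (e_0 + e_4).\<close>
      by (intro fixes_absurd[of "vec8 1 1 1 1 1 1 1 1"])
        (auto simp: Sigma0_def Sigma0_mult_vec8 neq)
  qed
qed

theorem theorem2:
  shows "gen_group Sigma0 = WE8 \<and> (\<forall>T. T \<subset> Sigma0 \<longrightarrow> gen_group T \<noteq> WE8)"
proof (intro conjI allI impI)
  show gen: "gen_group Sigma0 = WE8"
    using gen_group_Sigma0_subset_WE8 WE8_subset_gen_group_Sigma0 by (rule subset_antisym)
  fix T assume T: "T \<subset> Sigma0"
  \<comment> \<open>A generator missing from T is outside even the group generated by the other
    three, and that group contains the one generated by T.\<close>
  then obtain A where A: "A \<in> Sigma0" "A \<notin> T" by auto
  then have "T \<subseteq> gen_group (Sigma0 - {A})" using T by (auto intro: gen_group.gen_base)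
  then have "A \<notin> gen_group T" using gen_group_mono Sigma0_minimal[OF A(1)] by blast
  then show "gen_group T \<noteq> WE8" using A(1) Sigma0_subset_WE8 by auto
qed

end
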